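(* Let $(G,C)$ be an edge-colored graph on $n$ vertices with minimum color degree $\delta^c(G)$ such that $e(G)$ is minimal. Let $V(G)=\{v_1,v_2,\ldots,v_n\}$ be such that $d^{mon}_G(v_1)\geq d^{mon}_G(v_2)\geq \cdots \geq d^{mon}_G(v_n)$. Then for each integer $k$ with $1\leq k\leq \delta^c(G)-1$, $$\sum_{i=1}^k rt(G;v_i)\geq\frac{1}{2}\left(\sum_{i=1}^k d^{mon}_G(v_i)+k(\delta^c(G)-1)\right)(\overline{\sigma}_2^c(G)-n)+\frac{\Delta_k(G)}{2},$$ where $$\Delta_k(G)=\delta^c(G)\sum_{i=1}^{k}d^{mon}_G(v_i)-k\sum_{i=1}^{\delta^c(G)}d^{mon}_G(v_i).$$
   Context: All graphs are finite, undirected and simple. An edge-colored graph $(G,C)$ is a graph $G$ with an arbitrary function $C:E(G)\to\mathbb{N}$ (not necessarily a proper coloring). The color degree $d^c(v)$ is the number of distinct colors appearing on edges incident with $v$; $\delta^c(G)=\min_{v\in V(G)} d^c(v)$; $\overline{\sigma}^c_2(G)=\min\{d^c(x)+d^c(y):xy\in E(G)\}$. The monochromatic degree $d^{mon}_G(v)$ is the maximum number of edges incident with $v$ having the same color. A triangle is rainbow if its three edges have pairwise distinct colors; $rt(G;v)$ is the number of rainbow triangles of $G$ containing $v$. "$e(G)$ is minimal" means: deleting any single edge of $G$ decreases the color degree of some vertex of $G$. *)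

theory Defs
  imports Complex_Main
begin

text \<open>Graphs are given by a vertex set and a set of two-element edges. The vertex set is
  required to be nonempty, as the minimum color degree is a minimum over the vertices.\<close>

definition simple_graph :: "'a set \<Rightarrow> 'a set set \<Rightarrow> bool" where
  "simple_graph V E \<longleftrightarrow> finite V \<and> V \<noteq> {} \<and> (\<forall>e\<in>E. e \<subseteq> V \<and> card e = 2)"

text \<open>Colorings are total functions on sets of vertices. All notions below use only their
  values on edges.\<close>

definition color_degree :: "'a set set \<Rightarrow> ('a set \<Rightarrow> nat) \<Rightarrow> 'a \<Rightarrow> nat" where
  "color_degree E C v = card (C ` {e \<in> E. v \<in> e})"

definition min_color_degree :: "'a set \<Rightarrow> 'a set set \<Rightarrow> ('a set \<Rightarrow> nat) \<Rightarrow> nat" where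
  "min_color_degree V E C = Min (color_degree E C ` V)"

text \<open>Meaningful only when there is an edge, which holds whenever the minimum color degree
  is positive.\<close>

definition sigma2_bar :: "'a set set \<Rightarrow> ('a set \<Rightarrow> nat) \<Rightarrow> nat" where
  "sigma2_bar E C = Min {color_degree E C x + color_degree E C y | x y. {x, y} \<in> E}"

text \<open>The maximum ranges over all natural numbers as colors, so that it is 0 at an isolated
  vertex. The set of values is finite because it is bounded by the number of edges.\<close>

definition mon_degree :: "'a set set \<Rightarrow> ('a set \<Rightarrow> nat) \<Rightarrow> 'a \<Rightarrow> nat" where
  "mon_degree E C v = Max (range (\<lambda>c. card {e \<in> E. v \<in> e \<and> C e = c}))"

text \<open>A triangle is identified with its vertex set.\<close>

definition rainbow_triangle :: "'a set set \<Rightarrow> ('a set \<Rightarrow> nat) \<Rightarrow> 'a set \<Rightarrow> bool" where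
  "rainbow_triangle E C T \<longleftrightarrow>
     (\<exists>x y z. T = {x, y, z} \<and> distinct [x, y, z] \<and>
        {x, y} \<in> E \<and> {y, z} \<in> E \<and> {x, z} \<in> E \<and>
        distinct [C {x, y}, C {y, z}, C {x, z}])"

definition rt :: "'a set set \<Rightarrow> ('a set \<Rightarrow> nat) \<Rightarrow> 'a \<Rightarrow> nat" where
  "rt E C v = card {T. rainbow_triangle E C T \<and> v \<in> T}"

definition edge_minimal :: "'a set \<Rightarrow> 'a set set \<Rightarrow> ('a set \<Rightarrow> nat) \<Rightarrow> bool" where
  "edge_minimal V E C \<longleftrightarrow>
     (\<forall>e\<in>E. \<exists>v\<in>V. color_degree (E - {e}) C v < color_degree E C v)"

text \<open>The function \<open>v\<close> lists the vertices, with indices starting at 1.\<close>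

definition Delta ::
  "'a set \<Rightarrow> 'a set set \<Rightarrow> ('a set \<Rightarrow> nat) \<Rightarrow> (nat \<Rightarrow> 'a) \<Rightarrow> nat \<Rightarrow> real" where
  "Delta V E C v k =
     real (min_color_degree V E C) * (\<Sum>i=1..k. real (mon_degree E C (v i)))
     - real k * (\<Sum>i=1..min_color_degree V E C. real (mon_degree E C (v i)))"

end

theory Submission
  imports Defs
begin

text \<open>Minimality of the edge set means that the color of every edge is private at one of its two
  ends, so that the color classes are vertex-disjoint unions of stars
  (\<open>edge_minimal_private_color\<close>). This limits the monochromatic paths that spoil the usual
  common-neighbor count of rainbow triangles.

  Fix a vertex \<open>v\<close> of color degree \<open>D\<close> and monochromatic degree \<open>d\<close>. Let \<open>W\<close> consist of all
  neighbors of \<open>v\<close> in a largest color at \<open>v\<close> and one neighbor in each other color, which makes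
  \<open>d + D - 1\<close> vertices. For \<open>u\<close> in \<open>W\<close>, compare the vertices of \<open>W\<close> joined to \<open>v\<close> in a color other
  than that of \<open>uv\<close> with neighbors of \<open>u\<close> in distinct colors other than that of \<open>uv\<close>. Both sets
  lie in a set of \<open>n - 2\<close> vertices, so they share at least \<open>\<sigma> - n\<close> vertices \<open>w\<close>, and \<open>d - 1\<close> more
  if \<open>u\<close> is not in the large color (\<open>common_nbrs_bound\<close>). A shared \<open>w\<close> yields a rainbow triangle
  unless \<open>uw\<close> and \<open>vw\<close> have the same color. In that case \<open>w\<close> is the center of a monochromatic star
  containing \<open>v\<close> and \<open>u\<close>, so a given \<open>w\<close> is bad for at most \<open>d(w) - 1\<close> choices of \<open>u\<close>; moreover, \<open>w\<close>
  is not in the large color unless \<open>d = 1\<close>. Summing over \<open>u\<close> gives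
  \<open>2 rt(v) \<ge> (d + D - 1)(\<sigma> - n) + (\<Sum>w\<in>X. d - d(w))\<close> for a set \<open>X\<close> of at least \<open>D - 1\<close> vertices
  different from \<open>v\<close> (\<open>rainbow_triangles_at_vertex\<close>).

  It remains to replace \<open>D\<close> by \<open>\<delta>\<close>. The left side is nonnegative, so the right side may be
  multiplied by any factor in \<open>[0, 1]\<close>: the factor 1 serves if \<open>\<sigma> \<ge> n\<close>, and \<open>(\<delta> - 1) / (D - 1)\<close>
  if \<open>\<sigma> < n\<close>. After scaling, the sum over \<open>X\<close> is still at least the sum over the \<open>\<delta>\<close> vertices of
  largest monochromatic degree (\<open>scaled_deficit_bound\<close>). Adding up over \<open>v\<^sub>1, \<dots>, v\<^sub>k\<close> turns these
  sums into \<open>\<Delta>\<^sub>k\<close>.\<close>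

section \<open>Degrees in terms of neighbors\<close>

definition nbrs :: "'a set set \<Rightarrow> 'a \<Rightarrow> 'a set" where
  "nbrs E v = {u. {v, u} \<in> E}"

lemma nbrs_sym: "u \<in> nbrs E v \<longleftrightarrow> v \<in> nbrs E u"
  by (simp add: nbrs_def insert_commute)

lemma nbrs_subset:
  assumes "simple_graph V E"
  shows "nbrs E v \<subseteq> V - {v}"
proof
  fix u assume "u \<in> nbrs E v"
  then have "{v, u} \<in> E" by (simp add: nbrs_def)
  then have "{v, u} \<subseteq> V" "card {v, u} = 2" using assms unfolding simple_graph_def by blast+
  then show "u \<in> V - {v}" by auto
qed

lemma finite_nbrs:
  assumes "simple_graph V E"
  shows "finite (nbrs E v)"
  using nbrs_subset[OF assms, of v] assms unfolding simple_graph_def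
  by (meson finite_Diff finite_subset)

lemma incident_edges_eq:
  assumes "simple_graph V E"
  shows "{e \<in> E. v \<in> e} = (\<lambda>u. {v, u}) ` nbrs E v"
proof
  show "{e \<in> E. v \<in> e} \<subseteq> (\<lambda>u. {v, u}) ` nbrs E v"
  proof
    fix e assume e: "e \<in> {e \<in> E. v \<in> e}"
    then have "card e = 2" using assms by (auto simp: simple_graph_def)
    then obtain x y where "e = {x, y}" by (auto simp: card_2_iff)
    then obtain u where "e = {v, u}" using e by (auto simp: insert_commute)
    then show "e \<in> (\<lambda>u. {v, u}) ` nbrs E v" using e by (auto simp: nbrs_def)
  qed
qed (auto simp: nbrs_def)

lemma color_degree_nbrs:
  assumes "simple_graph V E"
  shows "color_degree E C v = card ((\<lambda>u. C {v, u}) ` nbrs E v)"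
  unfolding color_degree_def incident_edges_eq[OF assms] by (simp add: image_image)

lemma card_color_class:
  assumes "simple_graph V E"
  shows "card {e \<in> E. v \<in> e \<and> C e = c} = card {u \<in> nbrs E v. C {v, u} = c}"
proof -
  have "{e \<in> E. v \<in> e \<and> C e = c} = {e \<in> {e \<in> E. v \<in> e}. C e = c}" by auto
  also have "\<dots> = (\<lambda>u. {v, u}) ` {u \<in> nbrs E v. C {v, u} = c}"
    unfolding incident_edges_eq[OF assms] by auto
  finally have eq: "{e \<in> E. v \<in> e \<and> C e = c} = \<dots>" .
  have "inj_on (\<lambda>u. {v, u}) {u \<in> nbrs E v. C {v, u} = c}"
    by (rule inj_onI) (auto simp: doubleton_eq_iff)
  then show ?thesis unfolding eq by (rule card_image)
qed

lemma finite_color_class_sizes: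
  assumes "simple_graph V E"
  shows "finite (range (\<lambda>c. card {u \<in> nbrs E v. C {v, u} = c}))"
proof (rule finite_subset)
  show "range (\<lambda>c. card {u \<in> nbrs E v. C {v, u} = c}) \<subseteq> {..card (nbrs E v)}"
    using finite_nbrs[OF assms, of v] by (auto intro!: card_mono)
qed simp

lemma mon_degree_ge:
  assumes "simple_graph V E"
  shows "card {u \<in> nbrs E v. C {v, u} = c} \<le> mon_degree E C v"
  unfolding mon_degree_def card_color_class[OF assms]
  using finite_color_class_sizes[OF assms] by (intro Max_ge) auto

lemma mon_degree_attained:
  assumes "simple_graph V E"
  obtains c where "card {u \<in> nbrs E v. C {v, u} = c} = mon_degree E C v"
proof -
  have "mon_degree E C v \<in> range (\<lambda>c. card {u \<in> nbrs E v. C {v, u} = c})"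
    unfolding mon_degree_def card_color_class[OF assms]
    using finite_color_class_sizes[OF assms] by (intro Max_in) auto
  then show ?thesis using that by force
qed

lemma sigma2_bar_le:
  assumes "simple_graph V E" and "u \<in> nbrs E v"
  shows "sigma2_bar E C \<le> color_degree E C v + color_degree E C u"
proof -
  let ?f = "\<lambda>(x, y). color_degree E C x + color_degree E C y"
  have "{color_degree E C x + color_degree E C y | x y. {x, y} \<in> E} \<subseteq> ?f ` (V \<times> V)"
  proof safe
    fix x y assume "{x, y} \<in> E"
    then have "x \<in> V" "y \<in> V" using assms(1) unfolding simple_graph_def by blast+
    then show "color_degree E C x + color_degree E C y \<in> ?f ` (V \<times> V)" by force
  qed
  then have "finite {color_degree E C x + color_degree E C y | x y. {x, y} \<in> E}"
    using assms(1) unfolding simple_graph_def by (meson finite_SigmaI finite_imageI finite_subset)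
  then show ?thesis
    unfolding sigma2_bar_def using assms(2) by (intro Min_le) (auto simp: nbrs_def)
qed

section \<open>Color classes of an edge-minimal graph\<close>

text \<open>A second edge at \<open>x\<close> in the color of \<open>xy\<close> would keep that color present at \<open>x\<close> after the
  deletion of \<open>xy\<close>.\<close>

lemma color_degree_delete_edge_less:
  assumes "simple_graph V E" and "{x, y} \<in> E"
    and less: "color_degree (E - {{x, y}}) C x < color_degree E C x"
    and "z \<in> nbrs E x" and "C {x, z} = C {x, y}"
  shows "z = y"
proof (rule ccontr)
  assume "z \<noteq> y"
  then have z: "{x, z} \<in> {e \<in> E - {{x, y}}. x \<in> e}"
    using assms(4) by (auto simp: nbrs_def doubleton_eq_iff)
  have "C ` {e \<in> E. x \<in> e} \<subseteq> C ` {e \<in> E - {{x, y}}. x \<in> e}"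
  proof
    fix c assume "c \<in> C ` {e \<in> E. x \<in> e}"
    then obtain e where e: "e \<in> E" "x \<in> e" "c = C e" by auto
    show "c \<in> C ` {e \<in> E - {{x, y}}. x \<in> e}"
    proof (cases "e = {x, y}")
      case True
      then have "c = C {x, z}" using e assms(5) by simp
      then show ?thesis using z by blast
    qed (use e in auto)
  qed
  then have "C ` {e \<in> E - {{x, y}}. x \<in> e} = C ` {e \<in> E. x \<in> e}" by auto
  then show False using less by (simp add: color_degree_def)
qed

text \<open>Only the ends of an edge can lose a color when it is deleted, so its color is private at one
  of them. Hence there is no monochromatic path \<open>z x y t\<close>, and no monochromatic triangle
  (the case \<open>t = z\<close>).\<close>

lemma edge_minimal_private_color:
  assumes "simple_graph V E" and "edge_minimal V E C" and "y \<in> nbrs E x"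
    and "z \<in> nbrs E x" and "C {x, z} = C {x, y}" and "z \<noteq> y"
    and "t \<in> nbrs E y" and "C {y, t} = C {x, y}"
  shows "t = x"
proof -
  have e: "{x, y} \<in> E" using assms(3) by (simp add: nbrs_def)
  obtain p where p: "color_degree (E - {{x, y}}) C p < color_degree E C p"
    using assms(2) e unfolding edge_minimal_def by blast
  have "p \<in> {x, y}"
  proof (rule ccontr)
    assume "p \<notin> {x, y}"
    then have "{e \<in> E - {{x, y}}. p \<in> e} = {e \<in> E. p \<in> e}" by auto
    then show False using p by (simp add: color_degree_def)
  qed
  moreover have "p \<noteq> x"
    using color_degree_delete_edge_less[OF assms(1) e _ assms(4,5)] p assms(6) by blast
  ultimately have "color_degree (E - {{y, x}}) C y < color_degree E C y"
    using p by (auto simp: insert_commute)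
  then show ?thesis
    using color_degree_delete_edge_less[OF assms(1), of y x C t] e assms(7,8)
    by (simp add: insert_commute)
qed

section \<open>Rainbow triangles at a vertex\<close>

text \<open>Each rainbow triangle at \<open>v\<close> appears as two ordered pairs, one for either order of its other
  two vertices.\<close>

definition rainbow_pairs :: "'a set set \<Rightarrow> ('a set \<Rightarrow> nat) \<Rightarrow> 'a \<Rightarrow> ('a \<times> 'a) set" where
  "rainbow_pairs E C v = {(u, w). u \<in> nbrs E v \<and> w \<in> nbrs E v \<and> w \<in> nbrs E u \<and>
     distinct [C {v, u}, C {v, w}, C {u, w}]}"

lemma card_rainbow_pairs_le:
  assumes "simple_graph V E"
  shows "finite (rainbow_pairs E C v)" and "card (rainbow_pairs E C v) \<le> 2 * rt E C v"
proof -
  let ?P = "rainbow_pairs E C v" and ?T = "{T. rainbow_triangle E C T \<and> v \<in> T}"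
  let ?f = "\<lambda>(u, w). {v, u, w}"
  have "?P \<subseteq> nbrs E v \<times> nbrs E v" by (auto simp: rainbow_pairs_def)
  then show finP: "finite ?P" using finite_nbrs[OF assms] by (meson finite_SigmaI finite_subset)
  have "?T \<subseteq> Pow V"
  proof
    fix T assume "T \<in> ?T"
    then obtain x y z where "T = {x, y, z}" "{x, y} \<in> E" "{y, z} \<in> E"
      unfolding rainbow_triangle_def by blast
    moreover have "e \<subseteq> V" if "e \<in> E" for e using assms that by (simp add: simple_graph_def)
    ultimately show "T \<in> Pow V" by blast
  qed
  moreover have "finite V" using assms by (simp add: simple_graph_def)
  ultimately have finT: "finite ?T" by (meson finite_Pow_iff finite_subset)
  have ne: "x \<noteq> y" if "y \<in> nbrs E x" for x y
    using nbrs_subset[OF assms, of x] that by auto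
  have img: "?f p \<in> ?T" if "p \<in> ?P" for p
  proof -
    obtain u w where p: "p = (u, w)" by force
    have "rainbow_triangle E C {v, u, w}"
      unfolding rainbow_triangle_def
      using that ne[of u v] ne[of w v] ne[of w u] unfolding p
      by (intro exI[of _ v] exI[of _ u] exI[of _ w]) (auto simp: rainbow_pairs_def nbrs_def)
    then show ?thesis by (simp add: p)
  qed
  have fibre: "card {p \<in> ?P. ?f p = T} \<le> 2" for T
  proof (cases "\<exists>p. p \<in> ?P \<and> ?f p = T")
    case True
    then obtain u w where uw: "(u, w) \<in> ?P" "T = {v, u, w}" by auto
    have "{p \<in> ?P. ?f p = T} \<subseteq> {(u, w), (w, u)}"
    proof
      fix p assume p: "p \<in> {p \<in> ?P. ?f p = T}"
      obtain a b where ab: "p = (a, b)" by force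
      have "a \<noteq> v" "b \<noteq> v" "a \<noteq> b" "u \<noteq> v" "w \<noteq> v" "u \<noteq> w" "{v, a, b} = {v, u, w}"
        using p uw ab ne by (auto simp: rainbow_pairs_def)
      then show "p \<in> {(u, w), (w, u)}" unfolding ab by (auto simp: set_eq_iff)
    qed
    then have "card {p \<in> ?P. ?f p = T} \<le> card {(u, w), (w, u)}" by (rule card_mono[rotated]) simp
    also have "\<dots> \<le> 2" by (rule card_insert_le_m1) simp_all
    finally show ?thesis .
  next
    case False
    then have "{p \<in> ?P. ?f p = T} = {}" by blast
    then show ?thesis by (simp only: card.empty)
  qed
  have "?P = (\<Union>T\<in>?T. {p \<in> ?P. ?f p = T})" using img by auto
  then have "card ?P = card (\<Union>T\<in>?T. {p \<in> ?P. ?f p = T})" by (rule arg_cong)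
  also have "\<dots> \<le> (\<Sum>T\<in>?T. card {p \<in> ?P. ?f p = T})" by (rule card_UN_le[OF finT])
  also have "\<dots> \<le> (\<Sum>T\<in>?T. 2)" by (intro sum_mono fibre)
  finally show "card ?P \<le> 2 * rt E C v" by (simp add: rt_def)
qed

text \<open>Choose one neighbor of \<open>u\<close> for each color at \<open>u\<close> other than that of \<open>uv\<close>. These neighbors and
  \<open>A\<close> both avoid \<open>u\<close> and \<open>v\<close>, so they overlap by inclusion and exclusion.\<close>

lemma common_nbrs_bound:
  assumes g: "simple_graph V E" and u: "u \<in> nbrs E v" and A: "A \<subseteq> nbrs E v" "u \<notin> A"
  shows "real (card A) + real (color_degree E C u) - real (card V) + 1
    \<le> real (card {w \<in> A. w \<in> nbrs E u \<and> C {u, w} \<noteq> C {v, u}})"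
proof -
  have finV: "finite V" using g by (simp add: simple_graph_def)
  have vu: "v \<in> nbrs E u" using u by (simp add: nbrs_sym)
  let ?f = "\<lambda>w. C {u, w}"
  have "?f ` nbrs E u - {C {v, u}} \<subseteq> ?f ` nbrs E u" by auto
  then obtain Q where Q: "Q \<subseteq> nbrs E u" "inj_on ?f Q" "?f ` nbrs E u - {C {v, u}} = ?f ` Q"
    unfolding subset_image_inj by blast
  have "?f v \<in> ?f ` nbrs E u" using vu by blast
  then have "C {v, u} \<in> ?f ` nbrs E u" by (simp add: insert_commute)
  then have cQ: "real (card Q) = real (color_degree E C u) - 1"
    unfolding color_degree_nbrs[OF g] card_image[OF Q(2), symmetric] Q(3)[symmetric]
    using card.remove[of "?f ` nbrs E u" "C {v, u}"] finite_nbrs[OF g, of u] by simp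
  have finA: "finite A" "finite Q"
    using finite_nbrs[OF g] A(1) Q(1) by (auto intro: finite_subset)
  have "?f v \<notin> ?f ` Q" using Q(3) by (metis Diff_iff insertCI insert_commute)
  then have "v \<notin> Q" by blast
  then have "A \<union> Q \<subseteq> V - {u, v}"
    using A Q(1) nbrs_subset[OF g, of u] nbrs_subset[OF g, of v] by auto
  then have "card (A \<union> Q) \<le> card (V - {u, v})" using finV by (intro card_mono) auto
  moreover have "card (V - {u, v}) + 2 = card V"
  proof -
    have "u \<noteq> v" "{u, v} \<subseteq> V"
      using u vu nbrs_subset[OF g, of u] nbrs_subset[OF g, of v] by auto
    then show ?thesis using finV card_Diff_subset[of "{u, v}" V] card_mono[of V "{u, v}"] by auto
  qed
  moreover have "card A + card Q = card (A \<union> Q) + card (A \<inter> Q)"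
    by (rule card_Un_Int[OF finA])
  moreover have "card (A \<inter> Q) \<le> card {w \<in> A. w \<in> nbrs E u \<and> C {u, w} \<noteq> C {v, u}}"
  proof (intro card_mono)
    show "A \<inter> Q \<subseteq> {w \<in> A. w \<in> nbrs E u \<and> C {u, w} \<noteq> C {v, u}}"
      using Q(1) Q(3) by blast
  qed (use finA in auto)
  ultimately show ?thesis using cQ by linarith
qed

text \<open>The bound carries the color degree of \<open>v\<close> itself. Replacing it by the minimum color
  degree is left for later because the set \<open>X\<close> of possible bad vertices grows with it as well.\<close>

lemma rainbow_triangles_at_vertex:
  assumes g: "simple_graph V E" and min: "edge_minimal V E C" and ne: "nbrs E v \<noteq> {}"
  obtains X where "X \<subseteq> V - {v}" and "color_degree E C v \<le> card X + 1"
    and "(real (mon_degree E C v) + real (color_degree E C v) - 1)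
           * (real (sigma2_bar E C) - real (card V))
         + (\<Sum>w\<in>X. real (mon_degree E C v) - real (mon_degree E C w))
       \<le> 2 * real (rt E C v)"
proof -
  let ?N = "nbrs E v" and ?d = "mon_degree E C v" and ?D = "color_degree E C v"
  let ?s = "real (sigma2_bar E C) - real (card V)"
  let ?f = "\<lambda>u. C {v, u}"
  have finN: "finite ?N" by (rule finite_nbrs[OF g])
  obtain c where c: "card {u \<in> ?N. ?f u = c} = ?d" using mon_degree_attained[OF g] by blast
  define A where "A = {u \<in> ?N. ?f u = c}"
  have cA: "card A = ?d" and finA: "finite A" using c finN by (auto simp: A_def)
  obtain u0 where u0: "u0 \<in> ?N" using ne by blast
  have "{u0} \<subseteq> {u \<in> ?N. ?f u = ?f u0}" using u0 by auto
  then have "1 \<le> card {u \<in> ?N. ?f u = ?f u0}"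
    using finN card_mono[of "{u \<in> ?N. ?f u = ?f u0}" "{u0}"] by auto
  then have d1: "1 \<le> ?d" using mon_degree_ge[OF g, of v C "?f u0"] by linarith
  then have "A \<noteq> {}" using cA by auto
  then have cN: "c \<in> ?f ` ?N" by (auto simp: A_def)
  have "?f ` ?N - {c} \<subseteq> ?f ` ?N" by auto
  then obtain B where B: "B \<subseteq> ?N" "inj_on ?f B" "?f ` ?N - {c} = ?f ` B"
    unfolding subset_image_inj by blast
  have finB: "finite B" using B(1) finN finite_subset by blast
  have cB: "card B + 1 = ?D"
    unfolding color_degree_nbrs[OF g] card_image[OF B(2), symmetric] B(3)[symmetric]
    using card.remove[of "?f ` ?N" c] finN cN by simp
  have fB: "?f u \<noteq> c" if "u \<in> B" for u using B(3) that by blast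
  have fA: "?f u = c" if "u \<in> A" for u using that by (simp add: A_def)
  have AB: "A \<inter> B = {}" using fA fB by blast
  define W where "W = A \<union> B"
  have WN: "W \<subseteq> ?N" using B(1) by (auto simp: W_def A_def)
  have finW: "finite W" using finA finB by (simp add: W_def)
  have cW: "card W = ?d + card B" unfolding W_def using card_Un_disjoint[OF finA finB AB] cA by simp
  \<comment> \<open>The possible centers of monochromatic stars through \<open>v\<close>: a vertex of \<open>A\<close> can be one only if
    its color occurs once at \<open>v\<close>.\<close>
  define X where "X = (if ?d = 1 then W else B)"
  have XW: "X \<subseteq> W" by (auto simp: X_def W_def)
  have finX: "finite X" using XW finW finite_subset by blast
  \<comment> \<open>\<open>R u\<close> holds the third vertices in \<open>W\<close> of rainbow triangles on the edge \<open>vu\<close>; \<open>Z u\<close> contains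
    every common neighbor \<open>w\<close> lost because \<open>uw\<close> and \<open>vw\<close> have the same color.\<close>
  define R where "R u = {w \<in> W. w \<in> nbrs E u \<and> ?f w \<noteq> ?f u \<and> C {u, w} \<noteq> ?f u \<and> C {u, w} \<noteq> ?f w}" for u
  define Z where "Z u = {w \<in> X. u \<in> nbrs E w \<and> C {w, u} = C {w, v}}" for u
  have lower: "?s + (if u \<in> B then real ?d - 1 else 0) \<le> real (card (R u)) + real (card (Z u))"
    if uW: "u \<in> W" for u
  proof -
    let ?O = "{w \<in> W. ?f w \<noteq> ?f u}"
    have uN: "u \<in> ?N" using uW WN by auto
    \<comment> \<open>For \<open>u\<close> in \<open>B\<close> only \<open>u\<close> itself is excluded, for \<open>u\<close> in \<open>A\<close> all \<open>d\<close> vertices of \<open>A\<close>.\<close>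
    have O: "real (card ?O) = real ?D - 1 + (if u \<in> B then real ?d - 1 else 0)"
    proof (cases "u \<in> B")
      case True
      have "?f w \<noteq> ?f u" if "w \<in> W - {u}" for w
      proof (cases "w \<in> B")
        case wB: True
        then show ?thesis using that inj_onD[OF B(2) _ wB True] by blast
      next
        case False
        then have "?f w = c" using that fA by (auto simp: W_def)
        then show ?thesis using fB[OF True] by simp
      qed
      then have "?O = W - {u}" by auto
      then show ?thesis using True uW finW cW cB d1 by (simp add: card_Diff_singleton of_nat_diff)
    next
      case False
      then have "?O = B" using uW fA fB by (auto simp: W_def)
      then show ?thesis using False cB by simp
    qed
    have "{w \<in> ?O. w \<in> nbrs E u \<and> C {u, w} \<noteq> ?f u} \<subseteq> R u \<union> Z u"
    proof
      fix w assume w: "w \<in> {w \<in> ?O. w \<in> nbrs E u \<and> C {u, w} \<noteq> ?f u}"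
      show "w \<in> R u \<union> Z u"
      proof (cases "C {u, w} = ?f w")
        case False
        then show ?thesis using w by (auto simp: R_def)
      next
        case True
        have wN: "w \<in> ?N" using w WN by auto
        have uw: "u \<in> nbrs E w" "C {w, u} = ?f w"
          using w True by (auto simp: nbrs_sym insert_commute)
        \<comment> \<open>Otherwise \<open>vw\<close> has an edge of its own color at both ends: to another vertex of \<open>A\<close> at
          \<open>v\<close>, and to \<open>u\<close> at \<open>w\<close>.\<close>
        have "w \<in> X"
        proof (rule ccontr)
          assume "w \<notin> X"
          then have "w \<in> A" "?d \<noteq> 1" using w by (auto simp: X_def W_def split: if_splits)
          then have "A - {w} \<noteq> {}" using cA by (auto simp: subset_singleton_iff)
          then obtain z where "z \<in> A" "z \<noteq> w" by blast
          then have "u = v"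
            using edge_minimal_private_color[OF g min wN, of z u] \<open>w \<in> A\<close> uw by (auto simp: A_def)
          then show False using uN nbrs_subset[OF g, of v] by auto
        qed
        then show ?thesis using uw by (auto simp: Z_def insert_commute)
      qed
    qed
    then have "card {w \<in> ?O. w \<in> nbrs E u \<and> C {u, w} \<noteq> ?f u} \<le> card (R u \<union> Z u)"
      using finW finX by (intro card_mono) (auto simp: R_def Z_def)
    also have "\<dots> \<le> card (R u) + card (Z u)" by (rule card_Un_le)
    finally have "real (card ?O) + real (color_degree E C u) - real (card V) + 1
        \<le> real (card (R u)) + real (card (Z u))"
      using common_nbrs_bound[OF g uN, of ?O C] WN by force
    moreover have "real (sigma2_bar E C) \<le> real ?D + real (color_degree E C u)"
      using sigma2_bar_le[OF g uN, of C] by linarith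
    ultimately show ?thesis using O by linarith
  qed
  have "(\<Sum>u\<in>W. card (R u)) = card (SIGMA u:W. R u)"
    using finW by (simp add: R_def)
  also have "\<dots> \<le> card (rainbow_pairs E C v)"
    using WN by (intro card_mono card_rainbow_pairs_le(1)[OF g]) (auto simp: R_def rainbow_pairs_def)
  also have "\<dots> \<le> 2 * rt E C v" by (rule card_rainbow_pairs_le(2)[OF g])
  finally have sumR: "(\<Sum>u\<in>W. real (card (R u))) \<le> 2 * real (rt E C v)"
    unfolding of_nat_sum[symmetric] by linarith
  \<comment> \<open>Counted by the center \<open>w\<close>: the lost \<open>u\<close> and \<open>v\<close> are leaves of one color class at \<open>w\<close>.\<close>
  have "(\<Sum>u\<in>W. card (Z u)) = (\<Sum>w\<in>X. card {u \<in> W. u \<in> nbrs E w \<and> C {w, u} = C {w, v}})"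
    unfolding Z_def by (rule sum_multicount_gen) (use finW finX in auto)
  then have "(\<Sum>u\<in>W. real (card (Z u)))
      = (\<Sum>w\<in>X. real (card {u \<in> W. u \<in> nbrs E w \<and> C {w, u} = C {w, v}}))"
    unfolding of_nat_sum[symmetric] by (rule arg_cong)
  also have "\<dots> \<le> (\<Sum>w\<in>X. real (mon_degree E C w) - 1)"
  proof (intro sum_mono)
    fix w assume "w \<in> X"
    then have v: "v \<in> {u \<in> nbrs E w. C {w, u} = C {w, v}}" using XW WN by (auto simp: nbrs_sym)
    have fin: "finite {u \<in> nbrs E w. C {w, u} = C {w, v}}" using finite_nbrs[OF g] by auto
    have "{u \<in> W. u \<in> nbrs E w \<and> C {w, u} = C {w, v}} \<subseteq> {u \<in> nbrs E w. C {w, u} = C {w, v}} - {v}"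
      using WN nbrs_subset[OF g, of v] by auto
    then have "card {u \<in> W. u \<in> nbrs E w \<and> C {w, u} = C {w, v}}
        \<le> card ({u \<in> nbrs E w. C {w, u} = C {w, v}} - {v})"
      using fin by (intro card_mono) auto
    also have "\<dots> < card {u \<in> nbrs E w. C {w, u} = C {w, v}}"
      using v fin by (intro psubset_card_mono) auto
    also have "\<dots> \<le> mon_degree E C w" by (rule mon_degree_ge[OF g])
    finally show "real (card {u \<in> W. u \<in> nbrs E w \<and> C {w, u} = C {w, v}}) \<le> real (mon_degree E C w) - 1"
      by linarith
  qed
  finally have sumZ: "(\<Sum>u\<in>W. real (card (Z u))) \<le> (\<Sum>w\<in>X. real (mon_degree E C w) - 1)" .
  have "(\<Sum>u\<in>W. ?s + (if u \<in> B then real ?d - 1 else 0))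
      = real (card W) * ?s + real (card B) * (real ?d - 1)"
  proof -
    have "W \<inter> B = B" by (auto simp: W_def)
    then show ?thesis
      using finW by (simp add: sum.distrib sum.If_cases)
  qed
  moreover have "(\<Sum>u\<in>W. ?s + (if u \<in> B then real ?d - 1 else 0))
      \<le> (\<Sum>u\<in>W. real (card (R u)) + real (card (Z u)))"
    by (intro sum_mono lower)
  \<comment> \<open>\<open>X\<close> differs from \<open>B\<close> only if \<open>d = 1\<close>, when both sides vanish.\<close>
  moreover have "real (card B) * (real ?d - 1) = real (card X) * (real ?d - 1)"
    by (auto simp: X_def)
  moreover have "real (card W) = real ?d + real ?D - 1" using cW cB by linarith
  ultimately have "(real ?d + real ?D - 1) * ?s + (real (card X) * (real ?d - 1)
      - (\<Sum>w\<in>X. real (mon_degree E C w) - 1)) \<le> 2 * real (rt E C v)"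
    using sumR sumZ by (simp add: sum.distrib)
  moreover have "(\<Sum>w\<in>X. real ?d - real (mon_degree E C w))
      = real (card X) * (real ?d - 1) - (\<Sum>w\<in>X. real (mon_degree E C w) - 1)"
    by (simp add: sum_subtractf algebra_simps)
  ultimately have bound: "(real ?d + real ?D - 1) * ?s
      + (\<Sum>w\<in>X. real ?d - real (mon_degree E C w)) \<le> 2 * real (rt E C v)"
    by linarith
  have "X \<subseteq> V - {v}" using XW WN nbrs_subset[OF g, of v] by blast
  moreover have "?D \<le> card X + 1" using cB cW by (auto simp: X_def)
  ultimately show ?thesis using bound by (rule that)
qed

section \<open>Passing to the minimum color degree\<close>

text \<open>Measure all values from the \<open>m\<close>-th largest one: \<open>d i - d j = (d i - d m) - (d j - d m)\<close>. The
  first part is nonnegative and occurs \<open>card J\<close> times, so at least \<open>m - 1\<close> times after scaling. The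
  second part is positive only for \<open>j < m\<close>, so its sum over \<open>J\<close> is at most the full sum over the
  first \<open>m\<close> indices, and scaling does not increase that sum.\<close>

lemma scaled_deficit_bound:
  fixes d :: "nat \<Rightarrow> real" and l :: real
  assumes anti: "\<And>i j. 1 \<le> i \<Longrightarrow> i \<le> j \<Longrightarrow> j \<le> n \<Longrightarrow> d j \<le> d i"
    and i: "1 \<le> i" "i \<le> m" "m \<le> n" and J: "J \<subseteq> {1..n} - {i}"
    and l: "0 \<le> l" "l \<le> 1" "real m - 1 \<le> l * real (card J)"
  shows "(\<Sum>j=1..m. d i - d j) \<le> l * (\<Sum>j\<in>J. d i - d j)"
proof -
  let ?M = "{1..m} - {i}"
  have finJ: "finite J" using J finite_subset by blast
  have "(\<Sum>j\<in>J. d j - d m) \<le> (\<Sum>j\<in>J \<inter> {1..m}. d j - d m)"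
  proof -
    have "(\<Sum>j\<in>J. d j - d m) = (\<Sum>j\<in>J \<inter> {1..m}. d j - d m) + (\<Sum>j\<in>J - {1..m}. d j - d m)"
      using finJ by (rule sum.Int_Diff)
    moreover have "(\<Sum>j\<in>J - {1..m}. d j - d m) \<le> 0"
      using J i by (intro sum_nonpos) (auto intro!: anti)
    ultimately show ?thesis by linarith
  qed
  also have "\<dots> \<le> (\<Sum>j\<in>?M. d j - d m)"
    using J i by (intro sum_mono2) (auto intro!: anti)
  finally have le: "(\<Sum>j\<in>J. d j - d m) \<le> (\<Sum>j\<in>?M. d j - d m)" .
  have nn: "0 \<le> (\<Sum>j\<in>?M. d j - d m)" using i by (intro sum_nonneg) (auto intro!: anti)
  have cM: "real (card ?M) = real m - 1" using i by (simp add: of_nat_diff)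
  have split: "(\<Sum>j\<in>K. d i - d j) = real (card K) * (d i - d m) - (\<Sum>j\<in>K. d j - d m)" for K
    by (simp add: sum_subtractf algebra_simps)
  have "(\<Sum>j=1..m. d i - d j) = (\<Sum>j\<in>?M. d i - d j)"
    using i by (subst sum.remove[of _ i]) auto
  also have "\<dots> = (real m - 1) * (d i - d m) - (\<Sum>j\<in>?M. d j - d m)"
    unfolding split cM by simp
  also have "\<dots> \<le> l * real (card J) * (d i - d m) - l * (\<Sum>j\<in>J. d j - d m)"
  proof -
    have "(real m - 1) * (d i - d m) \<le> l * real (card J) * (d i - d m)"
      using l(3) anti[of i m] i by (intro mult_right_mono) auto
    moreover have "l * (\<Sum>j\<in>J. d j - d m) \<le> l * (\<Sum>j\<in>?M. d j - d m)"
      using le l(1) by (rule mult_left_mono)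
    moreover have "l * (\<Sum>j\<in>?M. d j - d m) \<le> (\<Sum>j\<in>?M. d j - d m)"
      using nn l(1,2) by (rule mult_left_le_one_le)
    ultimately show ?thesis by linarith
  qed
  also have "\<dots> = l * (\<Sum>j\<in>J. d i - d j)" unfolding split by (simp add: algebra_simps)
  finally show ?thesis .
qed

theorem theorem7:
  fixes V :: "'a set" and E :: "'a set set" and C :: "'a set \<Rightarrow> nat"
    and v :: "nat \<Rightarrow> 'a" and n k :: nat
  assumes "simple_graph V E"
    and "card V = n"
    and "edge_minimal V E C"
    and "bij_betw v {1..n} V"
    and "\<And>i j. 1 \<le> i \<Longrightarrow> i \<le> j \<Longrightarrow> j \<le> n \<Longrightarrow> mon_degree E C (v j) \<le> mon_degree E C (v i)"
    and "1 \<le> k" and "k \<le> min_color_degree V E C - 1"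
  shows "(\<Sum>i=1..k. real (rt E C (v i)))
    \<ge> 1 / 2 * ((\<Sum>i=1..k. real (mon_degree E C (v i)))
               + real k * (real (min_color_degree V E C) - 1))
            * (real (sigma2_bar E C) - real n)
      + Delta V E C v k / 2"
proof -
  note g = assms(1)
  let ?m = "min_color_degree V E C"
  let ?d = "\<lambda>i. real (mon_degree E C (v i))"
  let ?s = "real (sigma2_bar E C) - real n"
  have finV: "finite V" "V \<noteq> {}" using g by (auto simp: simple_graph_def)
  have mle: "?m \<le> color_degree E C x" if "x \<in> V" for x
    using that finV unfolding min_color_degree_def by (intro Min_le) auto
  have Dn: "color_degree E C x \<le> card (nbrs E x)" for x
    unfolding color_degree_nbrs[OF g] by (rule card_image_le[OF finite_nbrs[OF g]])
  have mn: "?m \<le> n"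
  proof -
    obtain x where x: "x \<in> V" using finV by blast
    have "card (nbrs E x) \<le> card V"
      using nbrs_subset[OF g, of x] finV by (intro card_mono) auto
    then show ?thesis using mle[OF x] Dn[of x] assms(2) by linarith
  qed
  have m2: "2 \<le> ?m" "k < ?m" using assms(6,7) by auto
  have vertex: "(?d i + real ?m - 1) * ?s + (\<Sum>j=1..?m. ?d i - ?d j) \<le> 2 * real (rt E C (v i))"
    if i: "i \<in> {1..k}" for i
  proof -
    have i': "1 \<le> i" "i \<le> ?m" "i \<in> {1..n}" using i m2 mn by auto
    have viV: "v i \<in> V" using assms(4) i'(3) by (auto simp: bij_betw_def)
    let ?D = "color_degree E C (v i)"
    have mD: "?m \<le> ?D" by (rule mle[OF viV])
    then have "nbrs E (v i) \<noteq> {}" using Dn[of "v i"] m2 by auto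
    then obtain X where X: "X \<subseteq> V - {v i}" "?D \<le> card X + 1"
      "(?d i + real ?D - 1) * ?s + (\<Sum>w\<in>X. ?d i - real (mon_degree E C w))
         \<le> 2 * real (rt E C (v i))"
      using assms(2) by (elim rainbow_triangles_at_vertex[OF g assms(3)]) simp
    define J where "J = {j \<in> {1..n}. v j \<in> X}"
    have vJ: "v ` J = X" using X(1) assms(4) by (fastforce simp: J_def bij_betw_def)
    have inj: "inj_on v J" 
    proof (rule inj_on_subset)
      show "inj_on v {1..n}" using assms(4) by (rule bij_betw_imp_inj_on)
    qed (auto simp: J_def)
    have JX: "card J = card X" using card_image[OF inj] vJ by simp
    have sumX: "(\<Sum>w\<in>X. ?d i - real (mon_degree E C w)) = (\<Sum>j\<in>J. ?d i - ?d j)"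
      unfolding vJ[symmetric] by (simp add: sum.reindex[OF inj])
    have J: "J \<subseteq> {1..n} - {i}" using X(1) by (auto simp: J_def)
    \<comment> \<open>If \<open>?s < 0\<close>, the excess of \<open>?D\<close> over \<open>?m\<close> makes the coefficient of \<open>?s\<close> too large, and this
      factor shrinks its part \<open>?D - 1\<close> to exactly \<open>?m - 1\<close>.\<close>
    define l :: real where "l = (if 0 \<le> ?s then 1 else (real ?m - 1) / (real ?D - 1))"
    have l: "0 \<le> l" "l \<le> 1" "real ?m - 1 \<le> l * (real ?D - 1)"
      using mD m2 by (auto simp: l_def field_simps)
    have "real ?D - 1 \<le> real (card J)" using X(2) JX by linarith
    then have "l * (real ?D - 1) \<le> l * real (card J)" using l(1) by (rule mult_left_mono)
    then have "real ?m - 1 \<le> l * real (card J)" using l(3) by linarith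
    then have sums: "(\<Sum>j=1..?m. ?d i - ?d j) \<le> l * (\<Sum>j\<in>J. ?d i - ?d j)"
      using assms(5) i' mn J l(1,2) by (intro scaled_deficit_bound[where n = n]) auto
    have coeff: "(?d i + real ?m - 1) * ?s \<le> l * ((?d i + real ?D - 1) * ?s)"
    proof (cases "0 \<le> ?s")
      case True
      then show ?thesis using mD by (simp add: l_def mult_right_mono)
    next
      case False
      have "l * (real ?D - 1) = real ?m - 1" using False mD m2 by (simp add: l_def)
      moreover have "l * ?d i \<le> ?d i" using l(1,2) by (intro mult_left_le_one_le) auto
      ultimately have "l * (?d i + real ?D - 1) \<le> ?d i + real ?m - 1"
        by (simp add: algebra_simps)
      then have "(?d i + real ?m - 1) * ?s \<le> l * (?d i + real ?D - 1) * ?s"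
        using False by (intro mult_right_mono_neg) auto
      then show ?thesis by (simp add: mult.assoc)
    qed
    have "(?d i + real ?m - 1) * ?s + (\<Sum>j=1..?m. ?d i - ?d j)
        \<le> l * ((?d i + real ?D - 1) * ?s + (\<Sum>j\<in>J. ?d i - ?d j))"
      using sums coeff by (simp add: distrib_left)
    also have "\<dots> \<le> l * (2 * real (rt E C (v i)))"
      using X(3) sumX l(1) by (intro mult_left_mono) auto
    also have "\<dots> \<le> 2 * real (rt E C (v i))" using l(1,2) by (intro mult_left_le_one_le) auto
    finally show ?thesis .
  qed
  have "(\<Sum>i=1..k. (?d i + real ?m - 1) * ?s + (\<Sum>j=1..?m. ?d i - ?d j))
      \<le> (\<Sum>i=1..k. 2 * real (rt E C (v i)))"
    by (intro sum_mono vertex)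
  moreover have "(\<Sum>i=1..k. (?d i + real ?m - 1) * ?s)
      = ((\<Sum>i=1..k. ?d i) + real k * (real ?m - 1)) * ?s"
    unfolding sum_distrib_right[symmetric] by (simp add: sum.distrib sum_subtractf algebra_simps)
  moreover have "(\<Sum>i=1..k. \<Sum>j=1..?m. ?d i - ?d j) = Delta V E C v k"
    unfolding Delta_def by (simp add: sum_subtractf sum_distrib_left)
  moreover have "(\<Sum>i=1..k. 2 * real (rt E C (v i))) = 2 * (\<Sum>i=1..k. real (rt E C (v i)))"
    by (simp add: sum_distrib_left)
  ultimately show ?thesis by (simp only: sum.distrib)
qed

end
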